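(* Suppose $n$ is an odd positive integer and $t$ is the multiplicative order of $2$ modulo $n$. Then, as $n\to\infty$ over odd integers, \[ P(n)\geq \exp\left[\left(\log 4+o(1)\right)\frac{t}{\sqrt{2n}}\right]. \]
   Context: Ducci sequences: for a positive integer $n$, a Ducci sequence is a sequence of integer $n$-tuples obtained by iterating the map $D:\mathbb{Z}^n\to\mathbb{Z}^n$, $D(a_1,a_2,\ldots,a_n)=(|a_1-a_2|,|a_2-a_3|,\ldots,|a_n-a_1|)$. Every such sequence is eventually periodic, and $P(n)$ denotes the largest (eventual, minimal) period among all Ducci sequences of integer $n$-tuples. Here $\log$ is the natural logarithm, and $o(1)$ denotes a quantity depending only on $n$ that tends to $0$ as $n\to\infty$ over odd integers. *)

theory Defs
  imports Complex_Main "HOL-Number_Theory.Number_Theory"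
begin

(* Integer n-tuples are represented by integer lists of length n. *)

text \<open>For \<open>xs = [a\<^sub>1, \<dots>, a\<^sub>n]\<close> the list \<open>rotate1 xs\<close> is \<open>[a\<^sub>2, \<dots>, a\<^sub>n, a\<^sub>1]\<close>.\<close>

definition ducci :: "int list \<Rightarrow> int list" where
  "ducci xs = map2 (\<lambda>a b. \<bar>a - b\<bar>) xs (rotate1 xs)"

definition ducci_seq :: "int list \<Rightarrow> nat \<Rightarrow> int list" where
  "ducci_seq xs k = (ducci ^^ k) xs"

text \<open>The least eventual period; meaningful for eventually periodic sequences only.\<close>

definition eventual_period :: "(nat \<Rightarrow> 'a) \<Rightarrow> nat" where
  "eventual_period s = (LEAST p. p > 0 \<and> (\<forall>\<^sub>F k in sequentially. s (k + p) = s k))"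

text \<open>
  \<open>Max\<close> is specified only for finite nonempty sets. Here the set is nonempty, and it is finite
  because, for fixed \<open>n\<close>, a tuple on a cycle has all its entries in \<open>{0, c}\<close> for some \<open>c\<close>, and
  scaling by \<open>c\<close> does not change the period.
\<close>

definition ducci_max_period :: "nat \<Rightarrow> nat" where
  "ducci_max_period n = Max {eventual_period (ducci_seq xs) | xs. length xs = n}"

end

theory Submission
  imports Defs "HOL-Algebra.Algebraic_Closure_Type" "HOL-Library.Z2" "HOL-Real_Asymp.Real_Asymp"
begin

text \<open>
  Write \<open>P(n)\<close> for the maximal period, and \<open>t\<close> for the order of \<open>2\<close> modulo the odd number \<open>n\<close>.

  In characteristic two, \<open>\<bar>a - b\<bar>\<close> is \<open>a + b\<close>. Pairing a tuple with the powers of \<open>\<eta>\<inverse>\<close>, for an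
  \<open>n\<close>-th root of unity \<open>\<eta>\<close>, therefore turns Ducci's map into multiplication by \<open>1 + \<eta>\<close>
  (\<open>tuple_eval_ducci\<close>). So the period \<open>p\<close> of the single sequence that starts at \<open>(1, 0, \<dots>, 0)\<close>
  satisfies \<open>(1 + \<eta>)\<^sup>p = 1\<close> for all \<open>\<eta> \<noteq> 1\<close> simultaneously
  (\<open>period_unit_vector_annihilates\<close>).

  Let \<open>\<theta>\<close> have exact order \<open>n\<close> in the algebraic closure of the field with two elements. Every
  product of factors \<open>1 + \<theta>\<^sup>k\<close> with \<open>0 < k < n\<close> is then a \<open>p\<close>-th root of unity, and a field
  contains at most \<open>p\<close> of these, so it suffices to find many different products. A product over
  a set \<open>A \<subseteq> {1..m}\<close> is the value at \<open>\<theta>\<close> of a polynomial of degree at most \<open>1 + \<dots> + m\<close> with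
  coefficients \<open>0\<close> and \<open>1\<close>. If two of these values agree at \<open>\<theta>\<close>, then by Frobenius they agree at
  the \<open>t\<close> different conjugates \<open>\<theta>\<close>, \<open>\<theta>\<^sup>2\<close>, \<open>\<theta>\<^sup>4\<close>, \<open>\<dots>\<close>; if moreover \<open>1 + \<dots> + m < t\<close>, then the
  polynomials coincide, and the lowest terms of the polynomials reveal the sets. Thus \<open>2\<^sup>m \<le> p\<close>
  (\<open>two_power_le_ducci_max_period\<close>).

  The largest admissible \<open>m\<close> is at least \<open>\<surd>(2t) - 2\<close>, whence \<open>ln P(n) \<ge> (\<surd>(2t) - 2) ln 2\<close>.
  Since \<open>t \<le> n\<close>, the quantity \<open>t / \<surd>(2n)\<close> is at most \<open>\<surd>(t / 2)\<close>, and this is the required bound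
  with \<open>\<epsilon> = - ln 4 \<surd>(2 / t)\<close>. The error tends to \<open>0\<close> because \<open>n < 2\<^sup>t\<close> forces \<open>t\<close> to infinity.

  That \<open>P(n)\<close>, a maximum, dominates the period \<open>p\<close> rests on only finitely many periods occurring.
  Every sequence ends in tuples with entries in \<open>{0, c}\<close> for some \<open>c\<close>, and dividing by \<open>c\<close> shows
  that its period already occurs for one of the \<open>2\<^sup>n\<close> tuples of zeros and ones
  (\<open>eventual_period_binary\<close>).
\<close>

section \<open>Ducci sequences end in two-valued tuples\<close>

lemma length_ducci [simp]: "length (ducci xs) = length xs"
  by (simp add: ducci_def)

lemma ducci_nth:
  assumes "i < length xs"
  shows "ducci xs ! i = \<bar>xs ! i - xs ! (Suc i mod length xs)\<bar>"
  using assms by (simp add: ducci_def nth_rotate1)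

lemma ducci_seq_0 [simp]: "ducci_seq xs 0 = xs"
  by (simp add: ducci_seq_def)

lemma ducci_seq_Suc: "ducci_seq xs (Suc k) = ducci (ducci_seq xs k)"
  by (simp add: ducci_seq_def)

lemma ducci_seq_add: "ducci_seq xs (k + j) = ducci_seq (ducci_seq xs k) j"
  by (induction j) (simp_all add: ducci_seq_Suc)

lemma ducci_seq_ducci: "ducci_seq (ducci xs) k = ducci_seq xs (Suc k)"
  using ducci_seq_add[of xs 1 k] by (simp add: ducci_seq_Suc)

lemma length_ducci_seq [simp]: "length (ducci_seq xs k) = length xs"
  by (induction k) (simp_all add: ducci_seq_Suc)

lemma ducci_bounded:
  assumes "set xs \<subseteq> {0..c}"
  shows "set (ducci xs) \<subseteq> {0..c}"
proof
  fix y assume "y \<in> set (ducci xs)"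
  then obtain i where i: "i < length xs" "y = ducci xs ! i"
    by (auto simp: in_set_conv_nth)
  have "xs ! i \<in> {0..c}"
    using assms i(1) nth_mem by blast
  moreover have "xs ! (Suc i mod length xs) \<in> {0..c}"
    using assms i(1) by (metis nth_mem mod_less_divisor subsetD gr_implies_not0 neq0_conv)
  ultimately show "y \<in> {0..c}"
    using i by (auto simp: ducci_nth)
qed

lemma ducci_seq_bounded:
  assumes "set xs \<subseteq> {0..c}"
  shows "set (ducci_seq xs k) \<subseteq> {0..c}"
  by (induction k) (simp_all add: assms ducci_seq_Suc ducci_bounded del: atLeastAtMost_iff)

text \<open>
  If all entries lie between \<open>0\<close> and \<open>c\<close>, a difference can be \<open>c\<close> only between \<open>0\<close> and \<open>c\<close>, and a
  neighbour that differs by \<open>0\<close> or \<open>c\<close> from an entry in \<open>{0, c}\<close> is again in \<open>{0, c}\<close>. So undoing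
  one step lengthens a cyclic run of entries in \<open>{0, c}\<close> that contains \<open>c\<close> by one, and a single
  entry \<open>c\<close> after \<open>k\<close> steps comes from such a run of length \<open>k + 1\<close>.
\<close>

lemma two_valued_run_grows:
  assumes "set xs \<subseteq> {0..c}" and "i < length xs" and "ducci_seq xs k ! i = c"
  shows "(\<forall>j\<le>k. xs ! ((i + j) mod length xs) \<in> {0, c}) \<and>
         (\<exists>j\<le>k. xs ! ((i + j) mod length xs) = c)"
  using assms
proof (induction k arbitrary: xs)
  case 0
  then show ?case by simp
next
  case (Suc k)
  define n where "n = length xs"
  define b where "b = (\<lambda>j. xs ! ((i + j) mod n))"
  have n: "n > 0" using Suc.prems(2) by (auto simp: n_def)
  have b_range: "b j \<in> {0..c}" for j
    using Suc.prems(1) n by (metis b_def n_def nth_mem mod_less_divisor subsetD)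
  have b_diff: "ducci xs ! ((i + j) mod n) = \<bar>b j - b (Suc j)\<bar>" for j
    using n by (subst ducci_nth) (simp_all add: b_def n_def mod_Suc_eq)
  have "(\<forall>j\<le>k. ducci xs ! ((i + j) mod length (ducci xs)) \<in> {0, c}) \<and>
        (\<exists>j\<le>k. ducci xs ! ((i + j) mod length (ducci xs)) = c)"
    using Suc.prems ducci_bounded by (intro Suc.IH) (simp_all add: ducci_seq_ducci)
  then have d: "\<And>j. j \<le> k \<Longrightarrow> \<bar>b j - b (Suc j)\<bar> \<in> {0, c}"
    and "\<exists>j\<le>k. \<bar>b j - b (Suc j)\<bar> = c"
    by (simp_all add: b_diff n_def[symmetric])
  then obtain j0 where j0: "j0 \<le> k" "\<bar>b j0 - b (Suc j0)\<bar> = c" by blast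
  have step: "b (Suc j) \<in> {0, c} \<longleftrightarrow> b j \<in> {0, c}" if "j \<le> k" for j
    using d[OF that] b_range[of j] b_range[of "Suc j"] by auto
  have all: "b j \<in> {0, c} \<longleftrightarrow> b 0 \<in> {0, c}" if "j \<le> Suc k" for j
    using that by (induction j) (use step in auto)
  have ends: "b j0 \<in> {0, c}" "b j0 = c \<or> b (Suc j0) = c"
    using j0(2) b_range[of j0] b_range[of "Suc j0"] by auto
  have "\<forall>j\<le>Suc k. b j \<in> {0, c}"
    using all ends(1) j0(1) by (meson le_SucI)
  moreover have "\<exists>j\<le>Suc k. b j = c"
    using ends(2) j0(1) by (metis le_SucI Suc_le_mono)
  ultimately show ?case
    by (simp add: b_def n_def)
qed

text \<open>
  The largest entry never increases, so it is eventually constant, say \<open>c\<close>. Looking back from an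
  entry \<open>c\<close> that is still present a full turn later, the run of entries in \<open>{0, c}\<close> covers the whole
  tuple. In the degenerate case of a sequence that dies out, \<open>{0, 1}\<close> serves as \<open>{0, c}\<close>, which keeps
  \<open>c\<close> positive and allows division by it.
\<close>

lemma ducci_seq_eventually_two_valued:
  obtains k c where "c > 0" and "set (ducci_seq xs k) \<subseteq> {0, c}"
proof -
  define P where "P = (\<lambda>c::nat. \<exists>k. set (ducci_seq xs k) \<subseteq> {0..int c})"
  have "P (nat (Max (insert 0 (set (ducci xs)))))"
    unfolding P_def
  proof (intro exI[of _ 1] subsetI)
    fix y assume "y \<in> set (ducci_seq xs 1)"
    then have y: "y \<in> set (ducci xs)" by (simp add: ducci_seq_Suc)
    have "y \<ge> 0" using y by (auto simp: in_set_conv_nth ducci_nth)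
    moreover have "y \<le> Max (insert 0 (set (ducci xs)))" using y by simp
    ultimately show "y \<in> {0..int (nat (Max (insert 0 (set (ducci xs)))))}" by simp
  qed
  then have P: "P (LEAST c. P c)" by (rule LeastI)
  define c where "c = (LEAST c. P c)"
  from P obtain k where k: "set (ducci_seq xs k) \<subseteq> {0..int c}"
    by (auto simp: P_def c_def)
  show thesis
  proof (cases "c = 0")
    case True
    with k have "set (ducci_seq xs k) \<subseteq> {0, 1}" by auto
    then show thesis using that[of 1] by simp
  next
    case False
    define ys where "ys = ducci_seq xs k"
    define n where "n = length ys"
    have bounded: "set (ducci_seq ys n) \<subseteq> {0..int c}"
      using k ducci_seq_bounded by (simp add: ys_def)
    have "\<not> P (c - 1)"
      using False not_less_Least[of "c - 1" P] by (simp add: c_def)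
    then have "\<not> set (ducci_seq xs (k + n)) \<subseteq> {0..int (c - 1)}"
      by (auto simp: P_def)
    then obtain y where y: "y \<in> set (ducci_seq ys n)" "y \<notin> {0..int (c - 1)}"
      unfolding ducci_seq_add ys_def by blast
    then have "y = int c"
      using bounded False by force
    with y(1) obtain i where i: "i < length ys" "ducci_seq ys n ! i = int c"
      by (auto simp: in_set_conv_nth)
    have run: "ys ! ((i + j) mod n) \<in> {0, int c}" if "j \<le> n" for j
      using two_valued_run_grows[OF _ i] k that by (simp add: ys_def n_def)
    have "ys ! l \<in> {0, int c}" if "l < n" for l
    proof (cases "i \<le> l")
      case True
      then show ?thesis using run[of "l - i"] that by simp
    next
      case False
      then show ?thesis using run[of "n + l - i"] that i(1) by (simp add: n_def)
    qed
    then have "set ys \<subseteq> {0, int c}"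
      by (metis in_set_conv_nth n_def subsetI)
    then show thesis using that[of "int c" k] False by (simp add: ys_def)
  qed
qed

section \<open>The maximal period\<close>

lemma eventual_period_shift: "eventual_period (\<lambda>j. s (k + j)) = eventual_period s"
proof -
  have "(\<forall>\<^sub>F j in sequentially. s (k + (j + p)) = s (k + j)) \<longleftrightarrow>
        (\<forall>\<^sub>F j in sequentially. s (j + p) = s j)" for p
    using eventually_sequentially_seg[of "\<lambda>j. s (j + p) = s j" k] by (simp add: ac_simps)
  then show ?thesis by (simp add: eventual_period_def)
qed

lemma eventual_period_inj: "inj f \<Longrightarrow> eventual_period (\<lambda>j. f (s j)) = eventual_period s"
  by (simp add: eventual_period_def inj_eq)

lemma ducci_seq_scale:
  assumes "c \<ge> 0"
  shows "ducci_seq (map ((*) c) xs) k = map ((*) c) (ducci_seq xs k)"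
proof (induction k)
  case (Suc k)
  have "ducci (map ((*) c) ys) = map ((*) c) (ducci ys)" for ys
  proof (rule nth_equalityI)
    fix i assume "i < length (ducci (map ((*) c) ys))"
    then have i: "i < length ys" by simp
    then have "Suc i mod length ys < length ys" by (metis gr_implies_not0 mod_less_divisor neq0_conv)
    with i have "(ducci (map ((*) c) ys)) ! i = \<bar>c * (ys ! i - ys ! (Suc i mod length ys))\<bar>"
      by (simp add: ducci_nth right_diff_distrib)
    with i show "ducci (map ((*) c) ys) ! i = map ((*) c) (ducci ys) ! i"
      using assms by (simp add: ducci_nth abs_mult)
  qed simp
  with Suc show ?case by (simp add: ducci_seq_Suc)
qed simp

abbreviation binary_tuples :: "nat \<Rightarrow> int list set" where
  "binary_tuples n \<equiv> {xs. set xs \<subseteq> {0, 1} \<and> length xs = n}"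

text \<open>
  Periods ignore initial segments and are invariant under scaling, which commutes with Ducci's map.
  Hence a two-valued tail can be replaced by a sequence of tuples of zeros and ones.
\<close>

lemma eventual_period_binary:
  "\<exists>bs \<in> binary_tuples (length xs). eventual_period (ducci_seq xs) = eventual_period (ducci_seq bs)"
proof -
  obtain k c where c: "c > 0" and kc: "set (ducci_seq xs k) \<subseteq> {0, c}"
    by (rule ducci_seq_eventually_two_valued)
  define bs where "bs = map (\<lambda>y. if y = 0 then 0 else 1 :: int) (ducci_seq xs k)"
  have "ducci_seq xs k = map ((*) c) bs"
    using kc unfolding bs_def map_map by (intro map_idI[symmetric]) auto
  then have "(\<lambda>j. ducci_seq xs (k + j)) = (\<lambda>j. map ((*) c) (ducci_seq bs j))"
    using c by (simp add: ducci_seq_add ducci_seq_scale)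
  then have "eventual_period (ducci_seq xs) = eventual_period (\<lambda>j. map ((*) c) (ducci_seq bs j))"
    by (metis eventual_period_shift)
  also have "\<dots> = eventual_period (ducci_seq bs)"
    using c by (intro eventual_period_inj inj_mapI injI) simp
  finally show ?thesis
    by (intro bexI[of _ bs]) (auto simp: bs_def)
qed

lemma eventual_period_le_max:
  assumes "length xs = n"
  shows "eventual_period (ducci_seq xs) \<le> ducci_max_period n"
  unfolding ducci_max_period_def
proof (rule Max_ge)
  have "{eventual_period (ducci_seq xs) |xs. length xs = n} \<subseteq>
        (\<lambda>bs. eventual_period (ducci_seq bs)) ` binary_tuples n"
    using eventual_period_binary by blast
  moreover have "finite (binary_tuples n)"
    by (rule finite_lists_length_eq) simp
  ultimately show "finite {eventual_period (ducci_seq xs) |xs. length xs = n}"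
    using finite_surj by blast
qed (use assms in blast)

text \<open>
  By the pigeonhole principle a sequence of tuples of zeros and ones repeats, so the least number
  in the definition of the eventual period does exist.
\<close>

lemma binary_eventual_period:
  assumes "set xs \<subseteq> {0, 1}"
  defines "p \<equiv> eventual_period (ducci_seq xs)"
  shows "p > 0" and "\<exists>k. ducci_seq xs (k + p) = ducci_seq xs k"
proof -
  have "set ys \<subseteq> {0, 1} \<longleftrightarrow> set ys \<subseteq> {0..1}" for ys :: "int list"
    by force
  then have "range (ducci_seq xs) \<subseteq> binary_tuples (length xs)"
    using assms(1) ducci_seq_bounded[of xs 1] by auto
  moreover have "finite (binary_tuples (length xs))"
    by (rule finite_lists_length_eq) simp
  ultimately have "\<not> inj (ducci_seq xs)"
    using finite_subset infinite_UNIV_nat finite_imageD by blast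
  then obtain i j where "i < j" "ducci_seq xs i = ducci_seq xs j"
    by (metis injI linorder_neqE_nat)
  moreover have "ducci_seq xs (k + (j - i)) = ducci_seq xs k"
    if "i < j" "ducci_seq xs i = ducci_seq xs j" "k \<ge> i" for i j k
  proof -
    have "ducci_seq xs (k + (j - i)) = ducci_seq (ducci_seq xs j) (k - i)"
      using that by (simp add: ducci_seq_add[symmetric] add.commute)
    also have "\<dots> = ducci_seq xs k"
      using that by (simp add: ducci_seq_add[symmetric] flip: that(2))
    finally show ?thesis .
  qed
  ultimately have "j - i > 0 \<and> (\<forall>\<^sub>F k in sequentially. ducci_seq xs (k + (j - i)) = ducci_seq xs k)"
    by (auto simp: eventually_sequentially)
  then have "p > 0 \<and> (\<forall>\<^sub>F k in sequentially. ducci_seq xs (k + p) = ducci_seq xs k)"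
    unfolding p_def eventual_period_def by (rule LeastI)
  then show "p > 0" "\<exists>k. ducci_seq xs (k + p) = ducci_seq xs k"
    by (auto simp: eventually_sequentially)
qed

section \<open>Roots of unity in characteristic two\<close>

definition exact_order :: "'a::monoid_mult \<Rightarrow> nat \<Rightarrow> bool" where
  "exact_order x n \<longleftrightarrow> (\<forall>k. x ^ k = 1 \<longleftrightarrow> n dvd k)"

lemma exact_order_mult:
  fixes x y :: "'a::comm_monoid_mult"
  assumes "exact_order x a" "exact_order y b" "coprime a b"
  shows "exact_order (x * y) (a * b)"
  unfolding exact_order_def
proof (intro allI iffI)
  fix k assume 1: "(x * y) ^ k = 1"
  have "x ^ a = 1" "y ^ b = 1"
    using assms by (simp_all add: exact_order_def)
  have "x ^ (k * b) * (y ^ b) ^ k = ((x * y) ^ k) ^ b"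
    by (simp add: power_mult_distrib power_mult[symmetric] mult.commute)
  then have "x ^ (k * b) = 1" using 1 \<open>y ^ b = 1\<close> by simp
  then have "a dvd k"
    using assms by (simp add: exact_order_def coprime_dvd_mult_left_iff)
  have "(x ^ a) ^ k * y ^ (k * a) = ((x * y) ^ k) ^ a"
    by (simp add: power_mult_distrib power_mult[symmetric] mult.commute)
  then have "y ^ (k * a) = 1" using 1 \<open>x ^ a = 1\<close> by simp
  then have "b dvd k"
    using assms by (simp add: exact_order_def coprime_dvd_mult_left_iff coprime_commute)
  with \<open>a dvd k\<close> show "a * b dvd k"
    using assms(3) by (simp add: divides_mult)
next
  fix k assume "a * b dvd k"
  then have "x ^ k = 1" "y ^ k = 1"
    using assms unfolding exact_order_def by (blast dest: dvd_mult_left dvd_mult_right)+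
  then show "(x * y) ^ k = 1" by (simp add: power_mult_distrib)
qed

text \<open>
  A root of \<open>1 + x + \<dots> + x\<^bsup>q-1\<^esup>\<close> is a \<open>q\<close>-th root of unity; it differs from \<open>1\<close> because the value at
  \<open>1\<close> is \<open>q \<noteq> 0\<close>.
\<close>

lemma exists_exact_order_prime:
  assumes "Factorial_Ring.prime q" and "of_nat q \<noteq> (0 :: 'a :: alg_closed_field)"
  shows "\<exists>x :: 'a. exact_order x q"
proof -
  have q: "q > 1" using assms(1) prime_gt_1_nat by blast
  have "\<exists>x::'a. (\<Sum>i\<le>q - 1. 1 * x ^ i) = 0"
    using q by (intro alg_closed) auto
  then obtain x :: 'a where "(\<Sum>i\<le>q - 1. x ^ i) = 0" by auto
  moreover have "{..q - 1} = {..<q}" using q by auto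
  ultimately have x: "(\<Sum>i<q. x ^ i) = 0" by simp
  then have "x \<noteq> 1" using assms(2) by auto
  have "x ^ q - 1 = (x - 1) * (\<Sum>i<q. x ^ i)"
    by (rule power_diff_1_eq)
  then have xq: "x ^ q = 1" using x by simp
  have "q dvd k" if "x ^ k = 1" for k
  proof (rule ccontr)
    assume "\<not> q dvd k"
    then have "coprime k q"
      using assms(1) by (metis prime_imp_coprime coprime_commute)
    moreover have "k \<noteq> 0" using \<open>\<not> q dvd k\<close> by (rule contrapos_nn) simp
    ultimately obtain u v where "k * u = q * v + 1"
      using bezout_nat[of k q] by auto
    then have "(x ^ k) ^ u = (x ^ q) ^ v * x"
      by (simp add: power_mult[symmetric] power_add)
    with that xq \<open>x \<noteq> 1\<close> show False by simp
  qed
  moreover have "x ^ k = 1" if "q dvd k" for k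
    using xq that by (auto simp: power_mult elim!: dvdE)
  ultimately show ?thesis
    by (auto simp: exact_order_def)
qed

text \<open>
  Roots of unity of exact order \<open>n\<close> are built up one prime factor \<open>q\<close> at a time: a \<open>q\<close>-th root
  raises the order by the factor \<open>q\<close> if \<open>q\<close> already divides it, and otherwise multiplication by an
  element of order \<open>q\<close> does.
\<close>

lemma exists_exact_order:
  assumes "of_nat n \<noteq> (0 :: 'a :: alg_closed_field)"
  shows "\<exists>x :: 'a. exact_order x n"
  using assms
proof (induction n rule: prime_divisors_induct)
  case zero
  then show ?case by simp
next
  case (unit n)
  then show ?case by (simp add: exact_order_def exI[of _ 1])
next
  case (factor q n)
  then have "of_nat n \<noteq> (0 :: 'a)" "of_nat q \<noteq> (0 :: 'a)" by auto
  with factor obtain w :: 'a where w: "exact_order w n" by blast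
  show ?case
  proof (cases "q dvd n")
    case True
    obtain z where z: "z ^ q = w"
      using nth_root_exists[of q w] factor.hyps prime_gt_0_nat by blast
    have "exact_order z (q * n)"
      unfolding exact_order_def
    proof (intro allI iffI)
      fix k assume k: "z ^ k = 1"
      have "w ^ k = (z ^ k) ^ q"
        by (simp add: z[symmetric] power_mult[symmetric] mult.commute)
      then have "n dvd k" using k w by (simp add: exact_order_def)
      with True have "q dvd k" by (rule dvd_trans)
      then obtain l where l: "k = q * l" by blast
      then have "w ^ l = 1" using k z by (simp add: power_mult)
      then show "q * n dvd k" using l w by (simp add: exact_order_def)
    next
      fix k assume "q * n dvd k"
      then show "z ^ k = 1"
        using w by (metis exact_order_def power_mult z dvd_mult_cancel_left dvdE dvd_triv_left)
    qed
    then show ?thesis by blast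
  next
    case False
    then have "coprime q n" using factor.hyps prime_imp_coprime by blast
    moreover obtain x :: 'a where "exact_order x q"
      using exists_exact_order_prime factor.hyps \<open>of_nat q \<noteq> (0 :: 'a)\<close> by blast
    ultimately show ?thesis using exact_order_mult w by blast
  qed
qed

lemma char2_add_self: "(2 :: 'a::comm_ring_1) = 0 \<Longrightarrow> x + x = (0 :: 'a)"
  by (metis mult_2 mult_zero_left)

lemma char2_square_sum:
  assumes "(2 :: 'a::comm_ring_1) = 0"
  shows "(x + y :: 'a)\<^sup>2 = x\<^sup>2 + y\<^sup>2"
  by (simp add: power2_sum assms)

section \<open>Ducci's map as multiplication\<close>

text \<open>
  The inverse powers match the direction of the shift: entry \<open>i\<close> of the rotated tuple is entry
  \<open>i + 1\<close> of the original one, so that rotation becomes multiplication by \<open>\<eta>\<close> rather than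
  \<open>\<eta>\<inverse>\<close>.
\<close>

definition tuple_eval :: "'a::field \<Rightarrow> int list \<Rightarrow> 'a" where
  "tuple_eval \<eta> xs = (\<Sum>i<length xs. of_int (xs ! i) * inverse \<eta> ^ i)"

lemma of_int_abs_diff_char2:
  assumes "(2 :: 'a::comm_ring_1) = 0"
  shows "of_int \<bar>a - b\<bar> = (of_int a + of_int b :: 'a)"
proof -
  have neg: "- x = x" for x :: 'a
    using char2_add_self[OF assms, of x] by (simp add: neg_eq_iff_add_eq_0)
  have "of_int \<bar>a - b\<bar> = (of_int (a - b) :: 'a)"
    using neg[of "of_int (a - b)"] by (metis abs_if of_int_minus)
  also have "\<dots> = of_int a + of_int b"
    using neg[of "of_int b"] by (metis of_int_diff diff_conv_add_uminus)
  finally show ?thesis .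
qed

lemma tuple_eval_ducci:
  assumes char2: "(2 :: 'a::field) = 0" and \<eta>: "\<eta> ^ length xs = (1 :: 'a)"
  shows "tuple_eval \<eta> (ducci xs) = (1 + \<eta>) * tuple_eval \<eta> xs"
proof (cases "length xs")
  case 0
  then show ?thesis by (simp add: tuple_eval_def)
next
  case (Suc m)
  define n where "n = length xs"
  define f where "f = (\<lambda>i. of_int (xs ! i) * inverse \<eta> ^ i)"
  have n: "n = Suc m" using Suc by (simp add: n_def)
  have \<eta>0: "\<eta> \<noteq> 0" using \<eta> Suc by auto
  \<comment> \<open>At the last index, where the tuple wraps around, this uses \<open>\<eta>\<^sup>n = 1\<close>.\<close>
  have wrap: "of_int (xs ! (Suc i mod n)) * inverse \<eta> ^ i = \<eta> * f (Suc i mod n)" if "i < n" for i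
  proof (cases "Suc i = n")
    case True
    have "\<eta> * \<eta> ^ i = 1" using \<eta> True by (simp add: n_def flip: power_Suc)
    then have "inverse \<eta> ^ i = \<eta>" using \<eta>0 by (metis inverse_unique mult.commute power_inverse)
    with True show ?thesis by (simp add: f_def mult.commute)
  next
    case False
    with that show ?thesis using \<eta>0 by (simp add: f_def)
  qed
  have shift: "(\<Sum>i<n. f (Suc i mod n)) = (\<Sum>i<n. f i)"
  proof -
    have "(\<Sum>i<n. f (Suc i mod n)) = (\<Sum>i<m. f (Suc i)) + f 0"
      by (simp add: n)
    also have "\<dots> = (\<Sum>i<n. f i)"
      by (simp add: n sum.lessThan_Suc_shift add.commute del: sum.lessThan_Suc)
    finally show ?thesis .
  qed
  have "tuple_eval \<eta> (ducci xs) =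
        (\<Sum>i<n. f i + of_int (xs ! (Suc i mod n)) * inverse \<eta> ^ i)"
    unfolding tuple_eval_def n_def length_ducci
    by (intro sum.cong refl)
       (simp add: ducci_nth of_int_abs_diff_char2[OF char2] f_def distrib_right)
  also have "\<dots> = (\<Sum>i<n. f i) + (\<Sum>i<n. \<eta> * f (Suc i mod n))"
    by (simp add: sum.distrib wrap)
  also have "\<dots> = (\<Sum>i<n. f i) + \<eta> * (\<Sum>i<n. f i)"
    by (simp add: sum_distrib_left[symmetric] shift)
  finally show ?thesis
    by (simp add: tuple_eval_def f_def n_def distrib_right)
qed

lemma tuple_eval_ducci_seq:
  assumes "(2 :: 'a::field) = 0" and "\<eta> ^ length xs = (1 :: 'a)"
  shows "tuple_eval \<eta> (ducci_seq xs k) = (1 + \<eta>) ^ k * tuple_eval \<eta> xs"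
  by (induction k) (simp_all add: ducci_seq_Suc tuple_eval_ducci assms)

text \<open>
  The unit vector evaluates to \<open>1\<close> at every \<open>\<eta>\<close>, so its sequence evaluates to the powers of
  \<open>1 + \<eta>\<close>; since \<open>1 + \<eta> \<noteq> 0\<close>, a repetition in the sequence cancels to \<open>(1 + \<eta>)\<^sup>p = 1\<close>.
\<close>

lemma period_unit_vector_annihilates:
  assumes char2: "(2 :: 'a::field) = 0" and \<eta>: "\<eta> ^ Suc m = (1 :: 'a)" "\<eta> \<noteq> 1"
  shows "(1 + \<eta>) ^ eventual_period (ducci_seq (1 # replicate m 0)) = 1"
proof -
  define e where "e = (1 :: int) # replicate m 0"
  define p where "p = eventual_period (ducci_seq e)"
  have "set e \<subseteq> {0, 1}" by (auto simp: e_def)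
  then obtain k where "ducci_seq e (k + p) = ducci_seq e k"
    unfolding p_def using binary_eventual_period(2) by blast
  then have "(1 + \<eta>) ^ (k + p) * tuple_eval \<eta> e = (1 + \<eta>) ^ k * tuple_eval \<eta> e"
    using tuple_eval_ducci_seq[OF char2, of \<eta> e] \<eta>(1) by (metis e_def length_Cons length_replicate)
  moreover have "tuple_eval \<eta> e = 1"
    by (simp add: tuple_eval_def e_def sum.lessThan_Suc_shift del: sum.lessThan_Suc)
  moreover have "1 + \<eta> \<noteq> 0"
    using \<eta>(2) char2_add_self[OF char2, of 1] by (metis add_left_cancel)
  ultimately have "(1 + \<eta>) ^ p = 1"
    by (simp add: power_add)
  then show ?thesis by (simp add: p_def e_def)
qed

section \<open>Distinct products of binomials\<close>

definition binomial_product :: "nat set \<Rightarrow> 'a::comm_ring_1 poly" where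
  "binomial_product A = (\<Prod>k\<in>A. 1 + Polynomial.monom 1 k)"

lemma poly_binomial_product: "poly (binomial_product A) x = (\<Prod>k\<in>A. 1 + x ^ k)"
  by (simp add: binomial_product_def poly_prod poly_monom)

lemma coeff_binomial_product_low:
  assumes "finite A" "\<And>j. j \<in> A \<Longrightarrow> k < j" "i \<le> k"
  shows "Polynomial.coeff (binomial_product A) i = (if i = 0 then 1 else 0)"
  using assms
proof (induction A rule: finite_induct)
  case empty
  then show ?case by (simp add: binomial_product_def)
next
  case (insert j A)
  have "i < j" using insert.prems by (metis insertI1 le_less_trans)
  then show ?case
    using insert by (simp add: binomial_product_def distrib_right coeff_monom_mult)
qed

text \<open>
  The coefficient of \<open>x\<^sup>k\<close> detects whether \<open>k\<close> belongs to the set, provided that no smaller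
  exponents interfere; this allows the set to be read off from below.
\<close>

lemma coeff_binomial_product_min:
  assumes "finite A" "\<And>j. j \<in> A \<Longrightarrow> k \<le> j" "k > 0"
  shows "Polynomial.coeff (binomial_product A :: 'a::comm_ring_1 poly) k = (if k \<in> A then 1 else 0)"
proof (cases "k \<in> A")
  case True
  \<comment> \<open>The other factors are congruent to \<open>1\<close> modulo \<open>x\<^bsup>k+1\<^esup>\<close>.\<close>
  have low: "Polynomial.coeff (binomial_product (A - {k}) :: 'a poly) i = (if i = 0 then 1 else 0)"
    if "i \<le> k" for i
    using assms that by (intro coeff_binomial_product_low[of _ k]) (auto simp: le_neq_implies_less)
  have "binomial_product A = (1 + Polynomial.monom 1 k) * (binomial_product (A - {k}) :: 'a poly)"
    using True assms(1) unfolding binomial_product_def by (rule prod.remove[rotated])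
  then have "Polynomial.coeff (binomial_product A :: 'a poly) k =
      Polynomial.coeff (binomial_product (A - {k}) :: 'a poly) k +
      Polynomial.coeff (binomial_product (A - {k}) :: 'a poly) 0"
    by (simp add: distrib_right coeff_monom_mult)
  then show ?thesis
    using True assms(3) low[of k] low[of 0] by simp
next
  case False
  with assms(2) have "k < j" if "j \<in> A" for j
    using that by (metis le_neq_implies_less)
  with False show ?thesis
    using assms by (subst coeff_binomial_product_low[of _ k]) auto
qed

text \<open>
  The smallest exponent of \<open>A \<union> B\<close> is recognised in the product, so it lies in both sets; its
  factor cancels.
\<close>

lemma binomial_product_inj:
  assumes "finite A" "finite B" "0 \<notin> A" "0 \<notin> B"
    and "binomial_product A = (binomial_product B :: 'a::idom poly)"
  shows "A = B"
  using assms
proof (induction "card (A \<union> B)" arbitrary: A B rule: less_induct)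
  case less
  show ?case
  proof (cases "A \<union> B = {}")
    case False
    define k where "k = Min (A \<union> B)"
    have k: "k \<in> A \<union> B" and le: "\<And>j. j \<in> A \<union> B \<Longrightarrow> k \<le> j"
      using less.prems False by (simp_all add: k_def del: Un_iff)
    have "k > 0" using k less.prems by (metis UnE gr0I)
    then have "k \<in> A \<longleftrightarrow> k \<in> B"
      using coeff_binomial_product_min[of A k, where 'a = 'a]
        coeff_binomial_product_min[of B k, where 'a = 'a] less.prems le
      by (auto split: if_splits)
    with k have kAB: "k \<in> A" "k \<in> B" by auto
    define g :: "'a poly" where "g = 1 + Polynomial.monom 1 k"
    have "Polynomial.coeff g 0 = 1" using \<open>k > 0\<close> by (simp add: g_def)
    then have "g \<noteq> 0" by auto
    moreover have "binomial_product A = g * binomial_product (A - {k})"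
      "binomial_product B = g * binomial_product (B - {k})"
      using kAB less.prems unfolding binomial_product_def g_def
      by (simp_all add: prod.remove)
    ultimately have "binomial_product (A - {k}) = (binomial_product (B - {k}) :: 'a poly)"
      using less.prems by simp
    moreover have "card ((A - {k}) \<union> (B - {k})) < card (A \<union> B)"
      using less.prems kAB by (intro psubset_card_mono) auto
    ultimately have "A - {k} = B - {k}"
      using less.prems by (intro less.hyps) auto
    with kAB show ?thesis by blast
  qed simp
qed

lemma degree_binomial_product:
  "finite A \<Longrightarrow> Polynomial.degree (binomial_product A :: 'a::comm_ring_1 poly) \<le> \<Sum>A"
proof (induction A rule: finite_induct)
  case (insert k A)
  have "Polynomial.degree (1 + Polynomial.monom (1::'a) k) \<le> k"
    by (rule degree_add_le) (simp_all add: degree_monom_le)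
  with insert show ?case
    using degree_mult_le[of "1 + Polynomial.monom (1::'a) k" "binomial_product A"]
    by (auto simp: binomial_product_def)
qed (simp add: binomial_product_def)

text \<open>
  Squaring is additive in characteristic two and fixes the coefficients \<open>0\<close> and \<open>1\<close>, so it moves the
  argument of the polynomial.
\<close>

lemma binomial_product_frobenius:
  assumes "(2 :: 'a::comm_ring_1) = 0"
  shows "poly (binomial_product A) (x ^ 2 ^ i) = (poly (binomial_product A) x :: 'a) ^ 2 ^ i"
proof (induction i)
  case (Suc i)
  have "poly (binomial_product A) (y\<^sup>2) = (poly (binomial_product A) y)\<^sup>2" for y :: 'a
    by (simp add: poly_binomial_product prod_power_distrib char2_square_sum[OF assms]
        power_mult[symmetric] mult.commute)
  from this[of "x ^ 2 ^ i"] Suc show ?case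
    by (simp add: power_mult[symmetric] mult.commute)
qed simp

text \<open>
  The bound on \<open>m\<close> keeps the degree of the difference of two products below the number \<open>ord n 2\<close> of
  conjugates of \<open>\<theta>\<close> at which it would have to vanish.
\<close>

lemma binomial_products_distinct:
  fixes \<theta> :: "'a::field"
  assumes char2: "(2 :: 'a) = 0" and \<theta>: "exact_order \<theta> n" and "n > 0"
    and m: "\<Sum>{1..m} < ord n 2"
  shows "inj_on (\<lambda>A. poly (binomial_product A) \<theta>) (Pow {1..m})"
proof (rule inj_onI)
  fix A B assume "A \<in> Pow {1..m}" "B \<in> Pow {1..m}"
    and eq: "poly (binomial_product A) \<theta> = poly (binomial_product B) \<theta>"
  then have A: "A \<subseteq> {1..m}" and B: "B \<subseteq> {1..m}" by auto
  have fin: "finite A" "finite B" using A B finite_subset by blast+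
  define t where "t = ord n 2"
  define g where "g = (binomial_product A - binomial_product B :: 'a poly)"
  have roots: "poly g (\<theta> ^ 2 ^ i) = 0" for i
    by (simp add: g_def binomial_product_frobenius[OF char2] eq)
  have inj: "inj_on (\<lambda>i. \<theta> ^ 2 ^ i) {..<t}"
  proof (rule linorder_inj_onI)
    fix i j assume ij: "i < j" "j \<in> {..<t}"
    have "\<theta> \<noteq> 0"
    proof
      assume "\<theta> = 0"
      moreover have "\<theta> ^ n = 1" using \<theta> by (simp add: exact_order_def)
      ultimately show False using \<open>n > 0\<close> by (simp add: zero_power)
    qed
    show "\<theta> ^ 2 ^ i \<noteq> \<theta> ^ 2 ^ j"
    proof
      assume same: "\<theta> ^ 2 ^ i = \<theta> ^ 2 ^ j"
      have "2 ^ j = 2 ^ i + (2 ^ j - 2 ^ i :: nat)"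
        using ij by simp
      then have "\<theta> ^ 2 ^ j = \<theta> ^ 2 ^ i * \<theta> ^ (2 ^ j - 2 ^ i)"
        by (metis power_add)
      then have "\<theta> ^ (2 ^ j - 2 ^ i) = 1"
        using same \<open>\<theta> \<noteq> 0\<close> by simp
      then have "n dvd 2 ^ j - 2 ^ i"
        using \<theta> by (simp add: exact_order_def)
      moreover have "coprime n 2"
        using ij m by (metis lessThan_iff not_less_zero ord_gt_0_iff t_def gr0I)
      moreover have "(2 :: nat) ^ i \<le> 2 ^ j"
        using ij by (intro power_increasing) auto
      ultimately have "[j = i] (mod t)"
        using order_divides_expdiff[of n 2 j i] by (simp add: cong_altdef_nat t_def)
      then show False using ij cong_less_modulus_unique_nat[of j i t] by simp
    qed
  qed auto
  have "g = 0"
  proof (rule ccontr)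
    assume "g \<noteq> 0"
    have "t = card ((\<lambda>i. \<theta> ^ 2 ^ i) ` {..<t})"
      by (simp add: card_image[OF inj])
    also have "\<dots> \<le> card {x. poly g x = 0}"
      using roots poly_roots_finite[OF \<open>g \<noteq> 0\<close>] by (intro card_mono) auto
    also have "\<dots> \<le> Polynomial.degree g"
      by (rule card_poly_roots_bound) (rule \<open>g \<noteq> 0\<close>)
    also have "\<dots> \<le> \<Sum>{1..m}"
      unfolding g_def
      using degree_binomial_product[OF fin(1), where 'a = 'a]
        degree_binomial_product[OF fin(2), where 'a = 'a]
        sum_mono2[of "{1..m}" A "\<lambda>k. k"] sum_mono2[of "{1..m}" B "\<lambda>k. k"] A B
      by (intro degree_diff_le) auto
    finally show False using m by (simp add: t_def)
  qed
  then show "A = B"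
    using A B fin by (intro binomial_product_inj[where 'a = 'a]) (auto simp: g_def)
qed

lemma order_two_less:
  fixes n :: nat
  assumes "odd n" "n > 1"
  shows "ord n 2 < n"
proof -
  have "ord n 2 dvd totient n"
    using assms by (intro order_divides_totient) (simp add: coprime_commute)
  then have "ord n 2 \<le> totient n"
    using assms by (intro dvd_imp_le) auto
  also have "\<dots> < n"
    using assms by (intro totient_less) auto
  finally show ?thesis .
qed

text \<open>
  The \<open>2\<^sup>m\<close> different products are all roots of \<open>x\<^sup>p - 1\<close>, where \<open>p\<close> is the period of the unit
  vector.
\<close>

theorem two_power_le_ducci_max_period:
  assumes n: "odd n" "n > 1" and m: "\<Sum>{1..m} < ord n 2"
  shows "2 ^ m \<le> ducci_max_period n"
proof -
  define e where "e = (1 :: int) # replicate (n - 1) 0"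
  define p where "p = eventual_period (ducci_seq e)"
  have "set e \<subseteq> {0, 1}" by (auto simp: e_def)
  then have "p > 0"
    unfolding p_def by (rule binary_eventual_period)
  have two: "(2 :: bit alg_closure) = 0"
    using to_ac_numeral[of "num.Bit0 num.One", where 'a = bit] by simp
  have "of_nat n = (1 :: bit alg_closure)"
    using n(1) two by (auto elim!: oddE)
  then obtain \<theta> :: "bit alg_closure" where \<theta>: "exact_order \<theta> n"
    using exists_exact_order[of n, where 'a = "bit alg_closure"] by auto
  have "m < n"
  proof -
    have "m \<le> \<Sum>{1..m}" by (cases m) auto
    with m order_two_less[OF n] show ?thesis by linarith
  qed
  have unit: "(1 + \<theta> ^ k) ^ p = 1" if "k \<in> {1..m}" for k
  proof -
    have "\<theta> ^ k \<noteq> 1"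
      using \<theta> that \<open>m < n\<close> by (auto simp: exact_order_def dest: dvd_imp_le)
    moreover have "(\<theta> ^ k) ^ Suc (n - 1) = 1"
      using \<theta> n by (simp add: exact_order_def power_mult[symmetric] del: power_Suc)
    ultimately show ?thesis
      using period_unit_vector_annihilates[OF two] by (simp add: p_def e_def)
  qed
  define h :: "bit alg_closure poly" where "h = Polynomial.monom 1 p - 1"
  have "Polynomial.coeff h p = 1" using \<open>p > 0\<close> by (simp add: h_def)
  then have "h \<noteq> 0" by auto
  have "poly h (poly (binomial_product A) \<theta>) = 0" if "A \<subseteq> {1..m}" for A
    using that unit
    by (auto simp: h_def poly_monom poly_binomial_product prod_power_distrib intro!: prod.neutral)
  then have "(\<lambda>A. poly (binomial_product A) \<theta>) ` Pow {1..m} \<subseteq> {x. poly h x = 0}"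
    by auto
  then have "card ((\<lambda>A. poly (binomial_product A) \<theta>) ` Pow {1..m}) \<le> card {x. poly h x = 0}"
    using poly_roots_finite[OF \<open>h \<noteq> 0\<close>] by (rule card_mono[rotated])
  also have "\<dots> \<le> Polynomial.degree h"
    by (rule card_poly_roots_bound) (rule \<open>h \<noteq> 0\<close>)
  also have "\<dots> \<le> p"
    unfolding h_def by (intro degree_diff_le) (simp_all add: degree_monom_le)
  also have "p \<le> ducci_max_period n"
    unfolding p_def using n by (intro eventual_period_le_max) (simp add: e_def)
  finally show ?thesis
    using binomial_products_distinct[OF two \<theta> _ m] n by (simp add: card_image card_Pow)
qed

section \<open>Asymptotics\<close>

text \<open>
  This holds because \<open>n\<close> divides \<open>2\<^sup>t - 1\<close>, where \<open>t\<close> is the order of \<open>2\<close>.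
\<close>

lemma less_two_power_order:
  fixes n :: nat
  assumes "odd n"
  shows "n < 2 ^ ord n 2"
proof -
  have "ord n 2 > 0" using assms by (simp add: coprime_commute)
  then have "2 ^ ord n 2 > (1 :: nat)" by (metis one_less_numeral_iff one_less_power semiring_norm(76))
  moreover have "n dvd 2 ^ ord n 2 - 1"
    using ord[of 2 n] by (simp add: cong_altdef_nat)
  ultimately have "n \<le> 2 ^ ord n 2 - 1" by (intro dvd_imp_le) auto
  with \<open>2 ^ ord n 2 > (1 :: nat)\<close> show ?thesis by linarith
qed

lemma order_two_tendsto_infinity:
  "filterlim (\<lambda>n::nat. ord n 2) at_top (inf at_top (principal {n. odd n}))"
  unfolding filterlim_at_top
proof
  fix Z :: nat
  have "Z \<le> ord n 2" if "n \<ge> 2 ^ Z" "odd n" for n :: nat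
  proof -
    have "2 ^ Z < (2 :: nat) ^ ord n 2"
      using that less_two_power_order[of n] by linarith
    then show ?thesis by simp
  qed
  then show "\<forall>\<^sub>F n :: nat in inf at_top (principal {n. odd n}). Z \<le> ord n 2"
    unfolding eventually_inf_principal
    by (auto intro: eventually_mono[OF eventually_ge_at_top[of "2 ^ Z"]])
qed

text \<open>
  The largest \<open>m\<close> with \<open>1 + \<dots> + m < t\<close> satisfies \<open>2t \<le> (m + 1)(m + 2) \<le> (m + 2)\<^sup>2\<close>; here \<open>t\<close> is the
  order of \<open>2\<close> modulo \<open>n\<close>.
\<close>

lemma ln_ducci_max_period_ge:
  assumes "odd n"
  shows "(sqrt (2 * real (ord n 2)) - 2) * ln 2 \<le> ln (real (ducci_max_period n))"
    and "1 \<le> ducci_max_period n"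
proof -
  define t where "t = ord n 2"
  have "t > 0" using assms by (simp add: t_def coprime_commute)
  \<comment> \<open>The first \<open>j\<close> whose successor is no longer admissible is the largest admissible number.\<close>
  define m where "m = (LEAST j. 2 * t \<le> (j + 1) * (j + 2))"
  have "2 * t \<le> (2 * t + 1) * (2 * t + 2)" by simp
  then have upper: "2 * t \<le> (m + 1) * (m + 2)"
    unfolding m_def by (rule LeastI)
  have lower: "m * (m + 1) < 2 * t"
  proof (cases m)
    case (Suc j)
    then have "\<not> 2 * t \<le> (j + 1) * (j + 2)"
      using not_less_Least[of j "\<lambda>j. 2 * t \<le> (j + 1) * (j + 2)"] by (simp add: m_def)
    with Suc show ?thesis by simp
  qed (use \<open>t > 0\<close> in simp)
  have pow: "2 ^ m \<le> ducci_max_period n"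
  proof (cases "n = 1")
    case True
    then have "t = 1" by (simp add: t_def)
    with lower have "m = 0" by (cases m) auto
    moreover have "eventual_period (ducci_seq [1]) > 0"
      by (rule binary_eventual_period) simp
    ultimately show ?thesis
      using eventual_period_le_max[of "[1]" n] True by simp
  next
    case False
    then have "n > 1" using assms by (cases n) auto
    moreover have "2 * \<Sum>{1..m} = m * (m + 1)"
      by (induction m) auto
    ultimately show ?thesis
      using lower assms by (intro two_power_le_ducci_max_period) (auto simp: t_def)
  qed
  then show ge1: "1 \<le> ducci_max_period n"
    using one_le_power[of "2::nat" m] by linarith
  have "2 * t \<le> (m + 2)\<^sup>2"
    using upper by (simp add: power2_eq_square)
  then have "real (2 * t) \<le> real ((m + 2)\<^sup>2)" by (rule of_nat_mono)
  then have "sqrt (2 * real t) \<le> real m + 2"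
    by (intro real_le_lsqrt) (auto simp: add.commute)
  then have "(sqrt (2 * real t) - 2) * ln 2 \<le> real m * ln 2"
    by (intro mult_right_mono) auto
  also have "\<dots> = ln (real (2 ^ m))"
    by (simp add: ln_realpow)
  also have "\<dots> \<le> ln (real (ducci_max_period n))"
    using pow ge1 by (subst ln_le_cancel_iff) (auto simp: of_nat_le_iff simp del: of_nat_power)
  finally show "(sqrt (2 * real (ord n 2)) - 2) * ln 2 \<le> ln (real (ducci_max_period n))"
    by (simp add: t_def)
qed

theorem corollary3p3:
  shows "\<exists>\<epsilon> :: nat \<Rightarrow> real.
    (\<epsilon> \<longlongrightarrow> 0) (inf at_top (principal {n. odd n})) \<and>
    (\<forall>n. odd n \<longrightarrow>
      real (ducci_max_period n) \<ge> exp ((ln 4 + \<epsilon> n) * (real (ord n 2) / sqrt (2 * real n))))"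
proof (intro exI conjI allI impI)
  define \<epsilon> :: "nat \<Rightarrow> real" where "\<epsilon> = (\<lambda>n. - ln 4 * sqrt (2 / real (ord n 2)))"
  have "((\<lambda>t. - ln 4 * sqrt (2 / real t)) \<longlongrightarrow> 0) at_top"
    by real_asymp
  then show "(\<epsilon> \<longlongrightarrow> 0) (inf at_top (principal {n. odd n}))"
    unfolding \<epsilon>_def using order_two_tendsto_infinity by (rule filterlim_compose)
  fix n :: nat assume n: "odd n"
  define t where "t = ord n 2"
  define x where "x = real t / sqrt (2 * real n)"
  have "t > 0" using n by (simp add: t_def coprime_commute)
  have "n > 0" using n by (cases n) auto
  have ln4: "ln 4 = 2 * ln (2 :: real)"
    using ln_realpow[of 2 2] by simp
  note ln_P = ln_ducci_max_period_ge[OF n, folded t_def]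
  have "(ln 4 + \<epsilon> n) * x \<le> ln (real (ducci_max_period n))"
    \<comment> \<open>For \<open>t = 1\<close> the coefficient is negative, and the trivial bound by \<open>1\<close> takes over.\<close>
  proof (cases "ln 4 + \<epsilon> n \<ge> 0")
    case True
    have "t \<le> n"
      using order_two_less[OF n] \<open>n > 0\<close> by (cases "n = 1") (auto simp: t_def)
    \<comment> \<open>All square roots are expressed through \<open>r\<close>; \<open>\<epsilon>\<close> is chosen so that \<open>(ln 4 + \<epsilon>) r\<close>
      equals \<open>(2 r - 2) ln 2\<close>.\<close>
    define r where "r = sqrt (real t / 2)"
    have "r > 0" using \<open>t > 0\<close> by (simp add: r_def)
    have "r\<^sup>2 = real t / 2" by (simp add: r_def)
    then have t: "real t = 2 * r\<^sup>2" by simp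
    have sqrt_2t: "sqrt (2 * real t) = 2 * r"
      using \<open>r > 0\<close> by (intro real_sqrt_unique) (simp_all add: t power_mult_distrib)
    have "sqrt (2 / real t) = 1 / r"
      using \<open>r > 0\<close> by (intro real_sqrt_unique) (simp_all add: t power_divide)
    then have \<epsilon>_r: "(ln 4 + \<epsilon> n) * r = ln 4 * (r - 1)"
      using \<open>r > 0\<close> by (simp add: \<epsilon>_def field_simps flip: t_def)
    have "x \<le> real t / sqrt (2 * real t)"
      unfolding x_def using \<open>t > 0\<close> \<open>t \<le> n\<close> by (intro divide_left_mono) auto
    also have "\<dots> = r"
      unfolding sqrt_2t unfolding t using \<open>r > 0\<close> by (simp add: power2_eq_square)
    finally have "(ln 4 + \<epsilon> n) * x \<le> (ln 4 + \<epsilon> n) * r"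
      using True by (rule mult_left_mono)
    also note \<epsilon>_r
    also have "ln 4 * (r - 1) = (sqrt (2 * real t) - 2) * ln 2"
      unfolding sqrt_2t ln4 by (simp add: algebra_simps)
    finally show ?thesis using ln_P(1) by linarith
  next
    case False
    have "x \<ge> 0" by (simp add: x_def)
    with False have "(ln 4 + \<epsilon> n) * x \<le> 0"
      by (intro mult_nonpos_nonneg) auto
    also have "0 \<le> ln (real (ducci_max_period n))"
      using ln_P(2) by simp
    finally show ?thesis .
  qed
  then have "exp ((ln 4 + \<epsilon> n) * x) \<le> real (ducci_max_period n)"
    using ln_P(2) by (simp flip: ln_ge_iff)
  then show "real (ducci_max_period n) \<ge>
      exp ((ln 4 + \<epsilon> n) * (real (ord n 2) / sqrt (2 * real n)))"
    by (simp add: x_def t_def)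
qed

end
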